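(* Let $a_0,a_1,c_1,c_2$ be integers with $c_2\neq 0$, let $W_m=W_m(a_0,a_1;c_1,c_2)$ and $U_m=W_m(0,1;c_1,c_2)$ for $m\in\mathbb{Z}$, and let $\Delta=a_1^2-c_1a_0a_1-c_2a_0^2$. Let $r\ge 0$ be an integer, let $s,k,n$ be integers, and let $d_1,\dots,d_r$ and $e_1,\dots,e_r$ be sequences of integers. Then $$\det\left( \prod_{\ell=j+1}^{r}W_{s+k(n+i+d_\ell)}\cdot \prod_{m=1}^{j}W_{s+k(n+i+e_m)} \right)_{0 \leq i,j \leq r}= (-\Delta)^{\binom{r+1}{2}}\cdot (-c_2)^{(s+kn)\binom{r+1}{2}+k\binom{r+1}{3}}\cdot \prod_{\ell=1}^r U_{k\ell}^{r+1-\ell}\prod_{1 \leq i \leq j \leq r}(-c_2)^{kd_j}U_{k(e_i-d_j)}.$$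
   Context: For integers $a,b,c_1,c_2$ with $c_2\ne 0$, $W_m(a,b;c_1,c_2)$ denotes the second-order linear recurrence with $W_0=a$, $W_1=b$ and $W_m=c_1W_{m-1}+c_2W_{m-2}$; the recurrence is used to extend the sequence to all negative indices as well (so the terms are rational numbers and the recurrence holds for all $m\in\mathbb{Z}$). The matrix is $(r+1)\times(r+1)$ with rows indexed by $i$ and columns by $j$; empty products equal $1$. In the last product, both factors $(-c_2)^{kd_j}$ and $U_{k(e_i-d_j)}$ are inside the product over $1\le i\le j\le r$. *)

theory Defs
  imports "Jordan_Normal_Form.Determinant"
begin

text \<open>
  The bi-infinite sequence determined by the initial values at indices 0 and 1 and the
  recurrence. At negative indices the recurrence is solved for its lowest term, so the
  terms are rational, and the value there is only meaningful if \<open>c2 \<noteq> 0\<close>.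
\<close>

function W :: "int \<Rightarrow> int \<Rightarrow> int \<Rightarrow> int \<Rightarrow> int \<Rightarrow> rat" where
  "W a b c1 c2 m =
     (if m = 0 then of_int a
      else if m = 1 then of_int b
      else if m > 1 then of_int c1 * W a b c1 c2 (m - 1) + of_int c2 * W a b c1 c2 (m - 2)
      else (W a b c1 c2 (m + 2) - of_int c1 * W a b c1 c2 (m + 1)) / of_int c2)"
  by pat_completeness auto
termination
  by (relation "Wellfounded.measure (\<lambda>(a, b, c1, c2, m). nat (if m \<ge> 0 then m else 1 - m))") auto

declare W.simps [simp del]

lemma W_0: "W a b c1 c2 0 = of_int a"
  by (simp add: W.simps)

lemma W_1: "W a b c1 c2 1 = of_int b"
  by (simp add: W.simps)

lemma W_rec:
  assumes "c2 \<noteq> 0"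
  shows "W a b c1 c2 m = of_int c1 * W a b c1 c2 (m - 1) + of_int c2 * W a b c1 c2 (m - 2)"
proof (cases "m > 1")
  case True
  then show ?thesis by (subst W.simps) simp
next
  case False
  then have "W a b c1 c2 (m - 2) = (W a b c1 c2 m - of_int c1 * W a b c1 c2 (m - 1)) / of_int c2"
    by (subst W.simps) simp
  then show ?thesis using assms by simp
qed

end

theory Submission
  imports Defs
begin

text \<open>
  By the addition formula, \<open>W\<close> at \<open>s + k (n + i + t)\<close> is a linear form, with coefficients
  depending only on \<open>t\<close>, at the point \<open>(W (p + 1), W p)\<close> with \<open>p = s + k (n + i)\<close>. For
  arbitrary points and linear forms such a determinant equals the product of all brackets of
  two points times the product of the brackets of the forms for \<open>d j\<close> and \<open>e i\<close> with
  \<open>i \<le> j\<close>; Cassini's identity evaluates each bracket.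
\<close>

section \<open>Second-order recurrences on all integers: addition formula and Cassini-type
  identities\<close>

lemma recurrence_unique:
  fixes f g :: "int \<Rightarrow> 'a::field"
  assumes v: "v \<noteq> 0"
    and f: "\<And>m. f (m + 2) = u * f (m + 1) + v * f m"
    and g: "\<And>m. g (m + 2) = u * g (m + 1) + v * g m"
    and init: "f 0 = g 0" "f 1 = g 1"
  shows "f m = g m"
proof -
  \<comment> \<open>Two consecutive values are carried along, since each step of the recurrence
    needs both; the downward step cancels \<open>v\<close>.\<close>
  have "f m = g m \<and> f (m + 1) = g (m + 1)"
  proof (induction m rule: int_induct[where k = 0])
    case base
    then show ?case using init by simp
  next
    case (step1 i)
    then show ?case using f[of i] g[of i] by (simp add: add.assoc)
  next
    case (step2 i)
    have "v * f (i - 1) = v * g (i - 1)"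
      using step2 f[of "i - 1"] g[of "i - 1"] by (simp add: algebra_simps)
    then show ?case using v step2 by simp
  qed
  then show ?thesis ..
qed

lemma W_add_2:
  assumes "c2 \<noteq> 0"
  shows "W a b c1 c2 (m + 2) = of_int c1 * W a b c1 c2 (m + 1) + of_int c2 * W a b c1 c2 m"
  using W_rec[OF assms, of a b c1 "m + 2"] by (simp add: algebra_simps)

text \<open>For fixed \<open>p\<close> both sides satisfy the same recurrence in \<open>q\<close>,
  so agreement at \<open>q = 0\<close> and \<open>q = 1\<close> suffices.\<close>

lemma W_add:
  assumes c2: "c2 \<noteq> 0"
  shows "W a b c1 c2 (p + q) =
    W 0 1 c1 c2 q * W a b c1 c2 (p + 1) + of_int c2 * W 0 1 c1 c2 (q - 1) * W a b c1 c2 p"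
proof (rule recurrence_unique[where u = "of_int c1" and v = "of_int c2" and m = q])
  show "of_int c2 \<noteq> (0::rat)" using c2 by simp
next
  fix m
  show "W a b c1 c2 (p + (m + 2)) =
      of_int c1 * W a b c1 c2 (p + (m + 1)) + of_int c2 * W a b c1 c2 (p + m)"
    using W_add_2[OF c2, of a b c1 "p + m"] by (simp add: algebra_simps)
next
  fix m
  show "W 0 1 c1 c2 (m + 2) * W a b c1 c2 (p + 1) +
        of_int c2 * W 0 1 c1 c2 (m + 2 - 1) * W a b c1 c2 p =
      of_int c1 * (W 0 1 c1 c2 (m + 1) * W a b c1 c2 (p + 1) +
        of_int c2 * W 0 1 c1 c2 (m + 1 - 1) * W a b c1 c2 p) +
      of_int c2 * (W 0 1 c1 c2 m * W a b c1 c2 (p + 1) +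
        of_int c2 * W 0 1 c1 c2 (m - 1) * W a b c1 c2 p)"
    using W_add_2[OF c2, of 0 1 c1 m] W_add_2[OF c2, of 0 1 c1 "m - 1"]
    by (simp add: algebra_simps)
next
  \<comment> \<open>The case \<open>q = 0\<close> involves index -1, where running the recurrence
    backwards gives 1 / \<open>c2\<close>.\<close>
  have "of_int c2 * W 0 1 c1 c2 (-1) = 1"
    using W_add_2[OF c2, of 0 1 c1 "-1"] by (simp add: W_0 W_1)
  then show "W a b c1 c2 (p + 0) = W 0 1 c1 c2 0 * W a b c1 c2 (p + 1) +
      of_int c2 * W 0 1 c1 c2 (0 - 1) * W a b c1 c2 p"
    by (simp add: W_0)
  show "W a b c1 c2 (p + 1) = W 0 1 c1 c2 1 * W a b c1 c2 (p + 1) +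
      of_int c2 * W 0 1 c1 c2 (1 - 1) * W a b c1 c2 p"
    by (simp add: W_0 W_1)
qed

text \<open>Raising \<open>p\<close> by one multiplies the left-hand side by \<open>- c2\<close>:
  after the recurrence is inserted, the \<open>c1\<close> terms cancel. The constant is the value at
  \<open>p = 0\<close>.\<close>

lemma W_cassini:
  assumes c2: "c2 \<noteq> 0"
  shows "W a b c1 c2 p * W a b c1 c2 (p + 2) - (W a b c1 c2 (p + 1))\<^sup>2 =
    of_int (- (b\<^sup>2 - c1 * a * b - c2 * a\<^sup>2)) * of_int (- c2) powi p"
proof -
  define h where "h p = W a b c1 c2 p * W a b c1 c2 (p + 2) - (W a b c1 c2 (p + 1))\<^sup>2" for p
  have c: "of_int (- c2) \<noteq> (0::rat)" using c2 by simp
  have step: "h (p + 1) = of_int (- c2) * h p" for p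
    using W_add_2[OF c2, of a b c1 p] W_add_2[OF c2, of a b c1 "p + 1"]
    by (simp add: h_def algebra_simps power2_eq_square)
  have "h p = h 0 * of_int (- c2) powi p"
  proof (induction p rule: int_induct[where k = 0])
    case (step1 i)
    then show ?case using c by (simp add: step power_int_add del: of_int_minus)
  next
    case (step2 i)
    then show ?case using c step[of "i - 1"]
      by (simp add: power_int_diff field_simps del: of_int_minus)
  qed simp
  moreover have "h 0 = of_int (- (b\<^sup>2 - c1 * a * b - c2 * a\<^sup>2))"
    using W_add_2[OF c2, of a b c1 0]
    by (simp add: h_def W_0 W_1 algebra_simps power2_eq_square)
  ultimately show ?thesis by (simp add: h_def)
qed

text \<open>Expand the terms at \<open>q\<close> and \<open>q + 1\<close> by \<open>W_add\<close>
  with the common shift \<open>q - p\<close>. The parts with index \<open>q - p - 1\<close> cancel,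
  and the rest is \<open>q - p\<close> in the (0,1) sequence times Cassini's expression at
  \<open>p\<close>.\<close>

lemma W_cross:
  assumes c2: "c2 \<noteq> 0"
  shows "W a b c1 c2 (q + 1) * W a b c1 c2 p - W a b c1 c2 (p + 1) * W a b c1 c2 q =
    of_int (- (b\<^sup>2 - c1 * a * b - c2 * a\<^sup>2)) * of_int (- c2) powi p * W 0 1 c1 c2 (q - p)"
  using W_add[OF c2, of a b c1 p "q - p"] W_add[OF c2, of a b c1 "p + 1" "q - p"]
  unfolding W_cassini[OF c2, symmetric]
  by (simp add: algebra_simps power2_eq_square)

section \<open>Determinants of products of binary linear forms\<close>

lemma det_scale_rows_cols:
  fixes M :: "nat \<times> nat \<Rightarrow> 'a::comm_ring_1"
  shows "det (mat n n (\<lambda>(i, j). u i * v j * M (i, j))) =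
    (\<Prod>i<n. u i) * (\<Prod>j<n. v j) * det (mat n n M)"
proof -
  have "(\<Prod>i = 0..<n. u i * v (p i) * M (i, p i)) =
      (\<Prod>i<n. u i) * (\<Prod>j<n. v j) * (\<Prod>i = 0..<n. M (i, p i))" if "p permutes {0..<n}" for p
    using prod.permute[OF that, of v] by (simp add: prod.distrib atLeast0LessThan)
  moreover have "p i < n" if "p permutes {0..<n}" "i < n" for p i
    using permutes_in_image[OF that(1), of i] that(2) by simp
  ultimately show ?thesis
    by (auto simp: det_def sum_distrib_left intro!: sum.cong)
qed

text \<open>
  The columns \<open>j\<close> and \<open>j + 1\<close> differ in a single linear factor, so a combination of them is
  divisible by the linear form that vanishes at the last point. This clears the last row
  except for its last entry.
\<close>

lemma det_binary_forms_generic: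
  fixes x y a b f g :: "nat \<Rightarrow> 'a::idom"
  assumes "\<And>i m. f m * x i + g m * y i \<noteq> 0"
  shows "det (mat (r + 1) (r + 1) (\<lambda>(i, j).
            (\<Prod>l\<in>{j + 1..r}. a l * x i + b l * y i) * (\<Prod>m\<in>{1..j}. f m * x i + g m * y i))) =
    (\<Prod>j\<le>r. \<Prod>i<j. x j * y i - x i * y j) * (\<Prod>j\<in>{1..r}. \<Prod>i\<in>{1..j}. b j * f i - a j * g i)"
proof (induction r arbitrary: a b)
  case 0
  show ?case by (simp add: det_single)
next
  case (Suc r)
  let ?D = "\<lambda>l i. a l * x i + b l * y i" and ?E = "\<lambda>m i. f m * x i + g m * y i"
  let ?N = "r + 2"
  define A where "A = mat ?N ?N (\<lambda>(i, j). (\<Prod>l\<in>{j + 1..Suc r}. ?D l i) * (\<Prod>m\<in>{1..j}. ?E m i))"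
  \<comment> \<open>Column \<open>j\<close> of \<open>A * T\<close> is column \<open>j\<close> of
    \<open>A\<close> times \<open>?E (Suc j)\<close> at the last point, minus column
    \<open>j + 1\<close> times \<open>?D (Suc j)\<close> there. The last column has no successor and
    stays unchanged, hence the value 1.\<close>
  define \<alpha> where "\<alpha> j = (if j = Suc r then 1 else ?E (Suc j) (Suc r))" for j
  define T where "T = mat ?N ?N (\<lambda>(t, j).
    (if t = j then \<alpha> j else 0) + (if t = Suc j then - ?D (Suc j) (Suc r) else 0))"
  \<comment> \<open>The 2 by 2 determinant of two forms evaluated at two points factors into a
    bracket of the points, \<open>u i\<close>, and a bracket of the forms,
    \<open>v j\<close>.\<close>
  define u where "u i = x (Suc r) * y i - x i * y (Suc r)" for i
  define v where "v j = b (Suc j) * f (Suc j) - a (Suc j) * g (Suc j)" for j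
  \<comment> \<open>This is the same matrix one size smaller, but with the \<open>a\<close>,
    \<open>b\<close> forms shifted by one; hence the induction over arbitrary \<open>a\<close> and
    \<open>b\<close>.\<close>
  define M where "M = (\<lambda>(i, j).
    (\<Prod>l\<in>{j + 1..r}. ?D (Suc l) i) * (\<Prod>m\<in>{1..j}. ?E m i))"
  have A [simp]: "A \<in> carrier_mat ?N ?N" and T [simp]: "T \<in> carrier_mat ?N ?N"
    by (simp_all add: A_def T_def)
  have AT: "(A * T) $$ (i, j) = (if j = Suc r then \<Prod>m\<in>{1..Suc r}. ?E m i else u i * v j * M (i, j))"
    if "i < ?N" "j < ?N" for i j
  proof -
    have "(A * T) $$ (i, j) = (\<Sum>t<?N. A $$ (i, t) * T $$ (t, j))"
      using that A T by (simp add: scalar_prod_def atLeast0LessThan)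
    also have "\<dots> = (\<Sum>t<?N. (if t = j then A $$ (i, t) * \<alpha> j else 0) +
        (if t = Suc j then A $$ (i, t) * (- ?D (Suc j) (Suc r)) else 0))"
      using that by (intro sum.cong) (auto simp: T_def)
    also have "\<dots> = A $$ (i, j) * \<alpha> j +
        (if Suc j < ?N then A $$ (i, Suc j) * (- ?D (Suc j) (Suc r)) else 0)"
      using that by (auto simp: sum.distrib less_Suc_eq)
    also have "\<dots> = (if j = Suc r then \<Prod>m\<in>{1..Suc r}. ?E m i else u i * v j * M (i, j))"
    proof (cases "j = Suc r")
      case True
      then show ?thesis using that by (simp add: A_def \<alpha>_def)
    next
      case False
      then have j: "j \<le> r" using that by simp
      have "(\<Prod>l\<in>{j + 1..Suc r}. ?D l i) = ?D (Suc j) i * (\<Prod>l\<in>{Suc j + 1..Suc r}. ?D l i)"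
        using j by (subst prod.atLeast_Suc_atMost) simp_all
      moreover have "(\<Prod>l\<in>{Suc j + 1..Suc r}. ?D l i) = (\<Prod>l\<in>{j + 1..r}. ?D (Suc l) i)"
        using prod.shift_bounds_cl_Suc_ivl[of "\<lambda>l. ?D l i" "j + 1" r] by simp
      ultimately show ?thesis
        using j that by (simp add: A_def \<alpha>_def M_def u_def v_def algebra_simps)
    qed
    finally show ?thesis .
  qed
  have u_last: "u (Suc r) = 0"
    by (simp add: u_def)
  have "det (A * T) = (\<Sum>j<?N. (A * T) $$ (Suc r, j) * cofactor (A * T) (Suc r) j)"
    by (rule laplace_expansion_row[OF mult_carrier_mat[OF A T]]) simp
  also have "\<dots> = (\<Sum>j<?N. if j = Suc r
      then (\<Prod>m\<in>{1..Suc r}. ?E m (Suc r)) * cofactor (A * T) (Suc r) (Suc r) else 0)"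
    by (intro sum.cong) (auto simp: AT u_last)
  also have "\<dots> = (\<Prod>m\<in>{1..Suc r}. ?E m (Suc r)) * cofactor (A * T) (Suc r) (Suc r)"
    by simp
  also have "cofactor (A * T) (Suc r) (Suc r) =
      det (mat (r + 1) (r + 1) (\<lambda>(i, j). u i * v j * M (i, j)))"
  proof -
    have "mat_delete (A * T) (Suc r) (Suc r) =
        mat (r + 1) (r + 1) (\<lambda>(i, j). u i * v j * M (i, j))"
      using carrier_matD[OF A] carrier_matD[OF T]
      by (intro eq_matI) (auto simp: mat_delete_def AT simp del: index_mult_mat(1))
    then show ?thesis by (simp add: cofactor_def)
  qed
  also have "\<dots> = (\<Prod>i<r + 1. u i) * (\<Prod>j<r + 1. v j) * det (mat (r + 1) (r + 1) M)"
    by (rule det_scale_rows_cols)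
  finally have det_AT: "det (A * T) = (\<Prod>m\<in>{1..Suc r}. ?E m (Suc r)) *
    ((\<Prod>i<r + 1. u i) * (\<Prod>j<r + 1. v j) * det (mat (r + 1) (r + 1) M))" .
  \<comment> \<open>\<open>T\<close> is lower bidiagonal, and its determinant is exactly the corner
    entry of \<open>A * T\<close>, so the two cancel once they are known to be nonzero.\<close>
  have "det T = prod_list (diag_mat T)"
    by (rule det_lower_triangular[of ?N]) (auto simp: T_def)
  also have "\<dots> = (\<Prod>j<?N. \<alpha> j)"
    unfolding prod_list_diag_prod by (simp add: T_def atLeast0LessThan)
  also have "\<dots> = (\<Prod>j<Suc r. ?E (Suc j) (Suc r))"
    by (simp add: \<alpha>_def)
  also have "\<dots> = (\<Prod>m\<in>{1..Suc r}. ?E m (Suc r))"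
    by (rule prod.reindex_bij_witness[where i = "\<lambda>m. m - 1" and j = Suc]) auto
  finally have det_T: "det T = (\<Prod>m\<in>{1..Suc r}. ?E m (Suc r))" .
  have "(\<Prod>m\<in>{1..Suc r}. ?E m (Suc r)) \<noteq> 0"
    using assms by (simp add: prod_zero_iff)
  with det_mult[OF A T] det_AT det_T
  have "det A = (\<Prod>i<r + 1. u i) * (\<Prod>j<r + 1. v j) * det (mat (r + 1) (r + 1) M)"
    by (metis mult.commute mult_cancel_left)
  also have "det (mat (r + 1) (r + 1) M) = (\<Prod>j\<le>r. \<Prod>i<j. x j * y i - x i * y j) *
      (\<Prod>j\<in>{1..r}. \<Prod>i\<in>{1..j}. b (Suc j) * f i - a (Suc j) * g i)"
    unfolding M_def by (rule Suc.IH)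
  also have "(\<Prod>i<r + 1. u i) * (\<Prod>j<r + 1. v j) * \<dots> =
      (\<Prod>j\<le>Suc r. \<Prod>i<j. x j * y i - x i * y j) * ((\<Prod>j<Suc r. v j) *
      (\<Prod>j\<in>{1..r}. \<Prod>i\<in>{1..j}. b (Suc j) * f i - a (Suc j) * g i))"
    by (simp add: u_def mult_ac)
  \<comment> \<open>After the shift the induction hypothesis covers the pairs with \<open>i\<close>
    \<le> \<open>j\<close> against the form \<open>Suc j\<close>; \<open>v j\<close> supplies the
    missing pair \<open>i = Suc j\<close>.\<close>
  also have "(\<Prod>j<Suc r. v j) * (\<Prod>j\<in>{1..r}. \<Prod>i\<in>{1..j}. b (Suc j) * f i - a (Suc j) * g i) =
      (\<Prod>j<Suc r. \<Prod>i\<in>{1..Suc j}. b (Suc j) * f i - a (Suc j) * g i)"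
  proof -
    have "(\<Prod>j\<in>{1..r}. \<Prod>i\<in>{1..j}. b (Suc j) * f i - a (Suc j) * g i) =
        (\<Prod>j<Suc r. \<Prod>i\<in>{1..j}. b (Suc j) * f i - a (Suc j) * g i)"
      by (intro prod.mono_neutral_left) auto
    then show ?thesis by (simp add: v_def prod.distrib mult_ac)
  qed
  also have "\<dots> = (\<Prod>j\<in>{1..Suc r}. \<Prod>i\<in>{1..j}. b j * f i - a j * g i)"
    by (rule prod.reindex_bij_witness[where i = "\<lambda>m. m - 1" and j = Suc]) auto
  finally show ?case by (simp add: A_def)
qed


text \<open>
  Over the polynomial ring the points \<open>(x i + X, y i)\<close> and the forms \<open>(f m + X, g m)\<close> pair to
  monic quadratics, so the generic case applies; then \<open>X\<close> is set to 0.
\<close>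

lemma det_binary_forms:
  fixes x y a b f g :: "nat \<Rightarrow> 'a::idom"
  shows "det (mat (r + 1) (r + 1) (\<lambda>(i, j).
            (\<Prod>l\<in>{j + 1..r}. a l * x i + b l * y i) * (\<Prod>m\<in>{1..j}. f m * x i + g m * y i))) =
    (\<Prod>j\<le>r. \<Prod>i<j. x j * y i - x i * y j) * (\<Prod>j\<in>{1..r}. \<Prod>i\<in>{1..j}. b j * f i - a j * g i)"
    (is "det ?M = ?R")
proof -
  interpret hom: comm_ring_hom "\<lambda>p::'a poly. poly p 0"
    by unfold_locales auto
  let ?A = "mat (r + 1) (r + 1) (\<lambda>(i, j).
    (\<Prod>l\<in>{j + 1..r}. [:a l:] * [:x i, 1:] + [:b l:] * [:y i:]) *
    (\<Prod>m\<in>{1..j}. [:f m, 1:] * [:x i, 1:] + [:g m:] * [:y i:]))"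
  have "det ?M = det (map_mat (\<lambda>p. poly p 0) ?A)"
    by (intro arg_cong[where f = det] eq_matI) (auto simp: poly_prod mult.commute)
  also have "\<dots> = poly (det ?A) 0"
    by (rule hom.hom_det)
  also have "det ?A = (\<Prod>j\<le>r. \<Prod>i<j. [:x j, 1:] * [:y i:] - [:x i, 1:] * [:y j:]) *
      (\<Prod>j\<in>{1..r}. \<Prod>i\<in>{1..j}. [:b j:] * [:f i, 1:] - [:a j:] * [:g i:])"
    by (rule det_binary_forms_generic) simp
  also have "poly \<dots> 0 = ?R"
    by (simp add: poly_prod mult.commute)
  finally show ?thesis .
qed

section \<open>Products over pairs of indices\<close>

lemma prod_diff_rows:
  fixes h :: "nat \<Rightarrow> 'a::comm_monoid_mult"
  shows "(\<Prod>j\<le>r. \<Prod>i<j. h (j - i)) = (\<Prod>l\<in>{1..r}. h l ^ (r + 1 - l))"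
proof (induction r)
  case (Suc r)
  \<comment> \<open>The new row \<open>j = Suc r\<close> contains each difference from 1 to
    \<open>Suc r\<close> once, so every exponent rises by one.\<close>
  have "(\<Prod>l\<in>{1..r}. h l ^ (r + 1 - l)) * (\<Prod>l\<in>{1..r}. h l) = (\<Prod>l\<in>{1..r}. h l ^ (r + 2 - l))"
    unfolding prod.distrib[symmetric]
    by (intro prod.cong) (auto simp: Suc_diff_le mult_ac)
  moreover have "(\<Prod>i<Suc r. h (Suc r - i)) = (\<Prod>l\<in>{1..Suc r}. h l)"
    by (rule prod.reindex_bij_witness[where i = "\<lambda>l. Suc r - l" and j = "\<lambda>i. Suc r - i"]) auto
  ultimately show ?case using Suc by (simp add: mult.assoc[symmetric])
qed simp

text \<open>There are \<open>(r + 1) choose 2\<close> pairs. Row \<open>j\<close> adds up the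
  \<open>i\<close> below \<open>j\<close> to \<open>j choose 2\<close>, and Pascal's rule sums these
  to \<open>(r + 1) choose 3\<close>.\<close>

lemma prod_powi_progression:
  fixes z c :: "'a::field"
  assumes "c \<noteq> 0"
  shows "(\<Prod>j\<le>r. \<Prod>i<j. z * c powi (t + k * int i)) =
    z ^ ((r + 1) choose 2) * c powi (t * int ((r + 1) choose 2) + k * int ((r + 1) choose 3))"
proof (induction r)
  case (Suc r)
  have row: "(\<Prod>i<n. z * c powi (t + k * int i)) =
      z ^ n * c powi (t * int n + k * int (n choose 2))" for n
    using assms
    by (induction n) (simp_all add: power_int_add[symmetric] algebra_simps numeral_2_eq_2)
  have "Suc (Suc r) choose 2 = (Suc r choose 2) + Suc r"
    and "Suc (Suc r) choose 3 = (Suc r choose 3) + (Suc r choose 2)"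
    by (simp_all add: numeral_eq_Suc)
  then show ?case
    using assms unfolding prod.atMost_Suc Suc.IH unfolding row
    by (simp add: power_int_add power_add algebra_simps)
qed (simp add: numeral_eq_Suc)

theorem theorem8:
  fixes a0 a1 c1 c2 s k n :: int
    and r :: nat
    and d e :: "nat \<Rightarrow> int"
    and \<Delta> :: int
    and V U :: "int \<Rightarrow> rat"
  assumes c2: "c2 \<noteq> 0"
    and V: "V = W a0 a1 c1 c2"
    and U: "U = W 0 1 c1 c2"
    and \<Delta>: "\<Delta> = a1\<^sup>2 - c1 * a0 * a1 - c2 * a0\<^sup>2"
  shows "det (mat (r + 1) (r + 1) (\<lambda>(i, j).
            (\<Prod>l\<in>{j + 1..r}. V (s + k * (n + int i + d l))) *
            (\<Prod>m\<in>{1..j}. V (s + k * (n + int i + e m)))))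
       = of_int (- \<Delta>) ^ ((r + 1) choose 2) *
         of_int (- c2) powi ((s + k * n) * int ((r + 1) choose 2) + k * int ((r + 1) choose 3)) *
         (\<Prod>l\<in>{1..r}. U (k * int l) ^ (r + 1 - l)) *
         (\<Prod>(i, j)\<in>{(i, j). 1 \<le> i \<and> i \<le> j \<and> j \<le> r}.
            of_int (- c2) powi (k * d j) * U (k * (e i - d j)))"
proof -
  define p where "p i = s + k * n + k * int i" for i
  define x where "x i = V (p i + 1)" for i
  define y where "y i = V (p i)" for i
  define v where "v t = of_int c2 * U (t - 1)" for t
  have c: "of_int (- c2) \<noteq> (0::rat)" using c2 by simp
  have form: "V (s + k * (n + int i + t)) = U (k * t) * x i + v (k * t) * y i" for i t
    using W_add[OF c2, of a0 a1 c1 "p i" "k * t"]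
    by (simp add: V U p_def x_def y_def v_def algebra_simps)
  have points: "x j * y i - x i * y j =
      (of_int (- \<Delta>) * of_int (- c2) powi (s + k * n + k * int i)) * U (k * int (j - i))"
    if "i < j" for i j
    using W_cross[OF c2, of a0 a1 c1 "p j" "p i"] that
    by (simp add: x_def y_def V U \<Delta> p_def of_nat_diff algebra_simps)
  have forms: "v (k * d j) * U (k * e i) - U (k * d j) * v (k * e i) =
      of_int (- c2) powi (k * d j) * U (k * (e i - d j))" for i j
  proof -
    \<comment> \<open>\<open>W_cross\<close> is applied below to \<open>U\<close> at indices lowered
      by one, where its constant is -1. The factor \<open>c2\<close> from \<open>v\<close> turns
      this sign and the exponent \<open>k * d j - 1\<close> into the full power of
      \<open>- c2\<close>.\<close>
    have "of_int (- c2) powi (k * d j) = (of_int (- c2) :: rat) * of_int (- c2) powi (k * d j - 1)"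
      using power_int_add[of "of_int (- c2) :: rat" 1 "k * d j - 1"] c by simp
    moreover have "U (k * e i) * U (k * d j - 1) - U (k * d j) * U (k * e i - 1) =
        - (of_int (- c2) powi (k * d j - 1)) * U (k * (e i - d j))"
      using W_cross[OF c2, of 0 1 c1 "k * e i - 1" "k * d j - 1"]
      by (simp add: U right_diff_distrib)
    moreover have "v (k * d j) * U (k * e i) - U (k * d j) * v (k * e i) =
        of_int c2 * (U (k * e i) * U (k * d j - 1) - U (k * d j) * U (k * e i - 1))"
      by (simp add: v_def algebra_simps)
    ultimately show ?thesis by simp
  qed
  have "(\<Prod>j\<le>r. \<Prod>i<j. x j * y i - x i * y j) =
      (\<Prod>j\<le>r. \<Prod>i<j. of_int (- \<Delta>) * of_int (- c2) powi (s + k * n + k * int i)) *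
      (\<Prod>j\<le>r. \<Prod>i<j. U (k * int (j - i)))"
    unfolding prod.distrib[symmetric] by (intro prod.cong refl points) simp
  moreover have "(\<Prod>j\<in>{1..r}. \<Prod>i\<in>{1..j}.
        of_int (- c2) powi (k * d j) * U (k * (e i - d j))) =
      (\<Prod>(i, j)\<in>{(i, j). 1 \<le> i \<and> i \<le> j \<and> j \<le> r}.
        of_int (- c2) powi (k * d j) * U (k * (e i - d j)))"
    unfolding prod.Sigma[OF finite_atLeastAtMost ballI[OF finite_atLeastAtMost]]
    by (rule prod.reindex_bij_witness[where i = prod.swap and j = prod.swap]) auto
  ultimately show ?thesis
    unfolding form
    by (simp only: det_binary_forms forms prod_powi_progression[OF c]
        prod_diff_rows[of "\<lambda>l. U (k * int l)"])
qed

end
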